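(* Let $(X,f)$ be a topological dynamical system. Every point $x\in X$ with $\omega_{B_*}(x)\neq\emptyset$ satisfies one and only one of the following sixteen cases: (1) $\emptyset\neq\omega_{B_*}(x)=\omega_{\underline{d}}(x)=\omega_{\overline{d}}(x)=\omega_{B^*}(x)=\omega_f(x)$; (2) $\emptyset\neq\omega_{B_*}(x)=\omega_{\underline{d}}(x)=\omega_{\overline{d}}(x)=\omega_{B^*}(x)\subsetneq\omega_f(x)$; (3) $\emptyset\neq\omega_{B_*}(x)\subsetneq\omega_{\underline{d}}(x)=\omega_{\overline{d}}(x)=\omega_{B^*}(x)=\omega_f(x)$; (4) $\emptyset\neq\omega_{B_*}(x)\subsetneq\omega_{\underline{d}}(x)=\omega_{\overline{d}}(x)=\omega_{B^*}(x)\subsetneq\omega_f(x)$; (5) $\emptyset\neq\omega_{B_*}(x)\subsetneq\omega_{\underline{d}}(x)=\omega_{\overline{d}}(x)\subsetneq\omega_{B^*}(x)=\omega_f(x)$; (6) $\emptyset\neq\omega_{B_*}(x)\subsetneq\omega_{\underline{d}}(x)=\omega_{\overline{d}}(x)\subsetneq\omega_{B^*}(x)\subsetneq\omega_f(x)$; (7) $\emptyset\neq\omega_{B_*}(x)=\omega_{\underline{d}}(x)\subsetneq\omega_{\overline{d}}(x)=\omega_{B^*}(x)=\omega_f(x)$; (8) $\emptyset\neq\omega_{B_*}(x)=\omega_{\underline{d}}(x)\subsetneq\omega_{\overline{d}}(x)=\omega_{B^*}(x)\subsetneq\omega_f(x)$; (9) $\emptyset\neq\omega_{B_*}(x)\subsetneq\omega_{\underline{d}}(x)\subsetneq\omega_{\overline{d}}(x)=\omega_{B^*}(x)=\omega_f(x)$;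 (10) $\emptyset\neq\omega_{B_*}(x)\subsetneq\omega_{\underline{d}}(x)\subsetneq\omega_{\overline{d}}(x)=\omega_{B^*}(x)\subsetneq\omega_f(x)$; (11) $\emptyset\neq\omega_{B_*}(x)=\omega_{\underline{d}}(x)\subsetneq\omega_{\overline{d}}(x)\subsetneq\omega_{B^*}(x)=\omega_f(x)$; (12) $\emptyset\neq\omega_{B_*}(x)=\omega_{\underline{d}}(x)\subsetneq\omega_{\overline{d}}(x)\subsetneq\omega_{B^*}(x)\subsetneq\omega_f(x)$; (13) $\emptyset\neq\omega_{B_*}(x)\subsetneq\omega_{\underline{d}}(x)\subsetneq\omega_{\overline{d}}(x)\subsetneq\omega_{B^*}(x)=\omega_f(x)$; (14) $\emptyset\neq\omega_{B_*}(x)\subsetneq\omega_{\underline{d}}(x)\subsetneq\omega_{\overline{d}}(x)\subsetneq\omega_{B^*}(x)\subsetneq\omega_f(x)$; (15) $\emptyset\neq\omega_{B_*}(x)=\omega_{\underline{d}}(x)=\omega_{\overline{d}}(x)\subsetneq\omega_{B^*}(x)=\omega_f(x)$; (16) $\emptyset\neq\omega_{B_*}(x)=\omega_{\underline{d}}(x)=\omega_{\overline{d}}(x)\subsetneq\omega_{B^*}(x)\subsetneq\omega_f(x)$.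
   Context: A topological dynamical system $(X,f)$ is a continuous map $f:X\to X$ on a compact metric space $(X,d)$. For $S\subseteq\mathbb{N}$ put $\overline{d}(S)=\limsup_{n\to\infty}\frac{|S\cap\{0,\dots,n-1\}|}{n}$, $\underline{d}(S)=\liminf_{n\to\infty}\frac{|S\cap\{0,\dots,n-1\}|}{n}$, $B^*(S)=\limsup_{|I|\to\infty}\frac{|S\cap I|}{|I|}$, $B_*(S)=\liminf_{|I|\to\infty}\frac{|S\cap I|}{|I|}$, where $I\subseteq\mathbb{N}$ ranges over finite intervals of consecutive integers. For $x\in X$ and $U\subseteq X$ let $N(x,U)=\{n\ge1: f^n(x)\in U\}$; let $V_\epsilon(y)$ be the ball of radius $\epsilon$ centered at $y$. For $\xi\in\{\overline{d},\underline{d},B^*,B_*\}$, $\omega_\xi(x)$ is the set of $y\in X$ such that $\xi(N(x,V_\epsilon(y)))>0$ for every $\epsilon>0$. $\omega_f(x)=\bigcap_{n\ge1}\overline{\bigcup_{k\ge n}\{f^k x\}}$ is the usual $\omega$-limit set. *)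

theory Defs
  imports "HOL-Analysis.Analysis"
begin

definition topological_dynamical_system :: "'a::metric_space set \<Rightarrow> ('a \<Rightarrow> 'a) \<Rightarrow> bool" where
  "topological_dynamical_system X f \<longleftrightarrow> compact X \<and> continuous_on X f \<and> f \<in> X \<rightarrow> X"

definition upper_density :: "nat set \<Rightarrow> ereal" where
  "upper_density S = limsup (\<lambda>n. ereal (real (card (S \<inter> {0..<n})) / real n))"

definition lower_density :: "nat set \<Rightarrow> ereal" where
  "lower_density S = liminf (\<lambda>n. ereal (real (card (S \<inter> {0..<n})) / real n))"

text \<open>The filter on sets of natural numbers along which a finite interval \<open>I\<close> of
  consecutive integers satisfies \<open>card I \<longrightarrow> \<infinity>\<close>, with no constraint on
  the position of \<open>I\<close>.\<close>
definition long_intervals :: "nat set filter" where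
  "long_intervals = inf (filtercomap card at_top) (principal {I. \<exists>a b. I = {a..<b}})"

definition upper_Banach_density :: "nat set \<Rightarrow> ereal" where
  "upper_Banach_density S =
     Limsup long_intervals (\<lambda>I. ereal (real (card (S \<inter> I)) / real (card I)))"

definition lower_Banach_density :: "nat set \<Rightarrow> ereal" where
  "lower_Banach_density S =
     Liminf long_intervals (\<lambda>I. ereal (real (card (S \<inter> I)) / real (card I)))"

definition visit_times :: "('a \<Rightarrow> 'a) \<Rightarrow> 'a \<Rightarrow> 'a set \<Rightarrow> nat set" where
  "visit_times f x U = {n. n \<ge> 1 \<and> (f ^^ n) x \<in> U}"

text \<open>Since \<open>X\<close> is a subset of an ambient metric type, balls and closures taken in the
  space \<open>X\<close> are the ambient ones intersected with \<open>X\<close>.\<close>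
definition omega_density ::
    "(nat set \<Rightarrow> ereal) \<Rightarrow> 'a::metric_space set \<Rightarrow> ('a \<Rightarrow> 'a) \<Rightarrow> 'a \<Rightarrow> 'a set" where
  "omega_density \<xi> X f x = {y \<in> X. \<forall>\<epsilon>>0. \<xi> (visit_times f x (X \<inter> ball y \<epsilon>)) > 0}"

definition omega_limit :: "'a::metric_space set \<Rightarrow> ('a \<Rightarrow> 'a) \<Rightarrow> 'a \<Rightarrow> 'a set" where
  "omega_limit X f x = (\<Inter>n\<in>{1..}. X \<inter> closure (\<Union>k\<in>{n..}. {(f ^^ k) x}))"

end

theory Submission
  imports Defs
begin

text \<open>Let \<open>ld\<close> and \<open>ud\<close> denote the lower and the upper density. The five sets form a chain
  \<open>\<omega>\<^bsub>B_*\<^esub> \<subseteq> \<omega>\<^bsub>ld\<^esub> \<subseteq> \<omega>\<^bsub>ud\<^esub>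
    \<subseteq> \<omega>\<^bsub>B^*\<^esub> \<subseteq> \<omega>\<^sub>f\<close>.
  The first three inclusions hold because the four densities of any set of
  natural numbers are ordered in the same way: the initial segments \<open>{0..<n}\<close> are among the
  intervals over which the Banach densities range. The last inclusion holds because a
  finite set has upper Banach density zero, so that a point of \<open>\<omega>\<^bsub>B^*\<^esub>\<close> has every
  neighbourhood visited infinitely often. The sixteen cases are the \<open>2 ^ 4\<close> ways in which each
  of the four inclusions can be an equality or strict; hence exactly one of them occurs.\<close>

lemma filterlim_initial_segments: "filterlim (\<lambda>n. {0..<n}) long_intervals sequentially"
  unfolding long_intervals_def
  by (auto simp: filterlim_inf filterlim_principal filterlim_filtercomap_iff o_def
      filterlim_ident intro!: always_eventually)

lemma lower_Banach_density_le_lower_density: "lower_Banach_density S \<le> lower_density S"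
proof -
  let ?r = "\<lambda>I. ereal (real (card (S \<inter> I)) / real (card I))"
  have "lower_Banach_density S \<le> Liminf (filtermap (\<lambda>n. {0..<n}) sequentially) ?r"
    unfolding lower_Banach_density_def Liminf_def
    using filterlim_initial_segments
    by (intro SUP_subset_mono) (auto simp: filterlim_def le_filter_def)
  also have "\<dots> \<le> liminf (\<lambda>n. ?r {0..<n})"
    by (rule Liminf_filtermap_le)
  finally show ?thesis
    by (simp add: lower_density_def)
qed

lemma lower_density_le_upper_density: "lower_density S \<le> upper_density S"
  unfolding lower_density_def upper_density_def
  by (rule Liminf_le_Limsup) simp

lemma upper_density_le_upper_Banach_density: "upper_density S \<le> upper_Banach_density S"
proof -
  let ?r = "\<lambda>I. ereal (real (card (S \<inter> I)) / real (card I))"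
  have "limsup (\<lambda>n. ?r {0..<n}) \<le> Limsup (filtermap (\<lambda>n. {0..<n}) sequentially) ?r"
    by (rule Limsup_filtermap_ge)
  also have "\<dots> \<le> upper_Banach_density S"
    unfolding upper_Banach_density_def Limsup_def
    using filterlim_initial_segments
    by (intro INF_superset_mono) (auto simp: filterlim_def le_filter_def)
  finally show ?thesis
    by (simp add: upper_density_def)
qed

lemma upper_Banach_density_finite:
  assumes "finite S"
  shows "upper_Banach_density S \<le> 0"
proof -
  have "filterlim card at_top long_intervals"
    unfolding long_intervals_def by (rule filterlim_mono[OF filterlim_filtercomap]) auto
  then have "((\<lambda>I. real (card S) / real (card I)) \<longlongrightarrow> 0) long_intervals"
    by (intro real_tendsto_divide_at_top[OF tendsto_const]
        filterlim_compose[OF filterlim_real_sequentially])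
  then have lim: "((\<lambda>I. ereal (real (card S) / real (card I))) \<longlongrightarrow> 0) long_intervals"
    by (simp add: zero_ereal_def)
  have nontrivial: "long_intervals \<noteq> bot"
    using filterlim_initial_segments
    by (metis bot_unique filterlim_def filtermap_bot_iff sequentially_bot)
  have "card (S \<inter> I) \<le> card S" for I
    using assms by (intro card_mono) auto
  then have "upper_Banach_density S
      \<le> Limsup long_intervals (\<lambda>I. ereal (real (card S) / real (card I)))"
    unfolding upper_Banach_density_def
    by (intro Limsup_mono always_eventually allI) (auto intro!: divide_right_mono)
  also have "\<dots> = 0"
    using nontrivial lim by (rule lim_imp_Limsup)
  finally show ?thesis .
qed

lemma omega_density_mono:
  assumes "\<And>S. \<xi> S \<le> \<eta> S"
  shows "omega_density \<xi> X f x \<subseteq> omega_density \<eta> X f x"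
  using assms unfolding omega_density_def by (auto intro: less_le_trans)

lemma omega_upper_Banach_subset_omega_limit:
  "omega_density upper_Banach_density X f x \<subseteq> omega_limit X f x"
proof
  fix y assume y: "y \<in> omega_density upper_Banach_density X f x"
  then have "y \<in> X"
    by (simp add: omega_density_def)
  moreover have "y \<in> closure (\<Union>k\<in>{n..}. {(f ^^ k) x})" for n
    unfolding closure_approachable
  proof (intro allI impI)
    fix e :: real assume "e > 0"
    with y have "0 < upper_Banach_density (visit_times f x (X \<inter> ball y e))"
      by (simp add: omega_density_def)
    then have "infinite (visit_times f x (X \<inter> ball y e))"
      using upper_Banach_density_finite leD by blast
    then obtain k where "k \<ge> n" "k \<in> visit_times f x (X \<inter> ball y e)"
      by (meson infinite_nat_iff_unbounded_le)
    then show "\<exists>z\<in>\<Union>k\<in>{n..}. {(f ^^ k) x}. dist z y < e"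
      by (auto simp: visit_times_def dist_commute)
  qed
  ultimately show "y \<in> omega_limit X f x"
    by (auto simp: omega_limit_def)
qed

text \<open>Counting the true entries turns the unique existence of an index into an equation that
  the simplifier can evaluate on a concrete list of cases.\<close>
lemma ex1_nth_iff_length_filter:
  assumes "length ps = n"
  shows "(\<exists>!i. i \<in> {1..n} \<and> ps ! (i - 1)) \<longleftrightarrow> length (filter (\<lambda>p. p) ps) = 1"
proof -
  have "{i. i \<in> {1..length ps} \<and> ps ! (i - 1)} = Suc ` {i. i < length ps \<and> ps ! i}"
    by (force simp: image_iff Suc_le_eq gr0_conv_Suc)
  then have "card {i. i \<in> {1..length ps} \<and> ps ! (i - 1)} = length (filter (\<lambda>p. p) ps)"
    by (simp add: card_image length_filter_conv_card)
  moreover have "(\<exists>!i. P i) \<longleftrightarrow> card {i. P i} = 1" for P :: "nat \<Rightarrow> bool"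
    by (auto simp: card_1_singleton_iff set_eq_iff)
  ultimately show ?thesis
    using assms by simp
qed

theorem theorem1p2:
  fixes X :: "'a::metric_space set" and f :: "'a \<Rightarrow> 'a" and x :: 'a
  assumes "topological_dynamical_system X f"
    and "x \<in> X"
    and "omega_density lower_Banach_density X f x \<noteq> {}"
  shows
    "let Bl = omega_density lower_Banach_density X f x;
         dl = omega_density lower_density X f x;
         du = omega_density upper_density X f x;
         Bu = omega_density upper_Banach_density X f x;
         om = omega_limit X f x
     in \<exists>!i. i \<in> {1..16::nat} \<and> [
        {} \<noteq> Bl \<and> Bl = dl \<and> dl = du \<and> du = Bu \<and> Bu = om,
        {} \<noteq> Bl \<and> Bl = dl \<and> dl = du \<and> du = Bu \<and> Bu \<subset> om,
        {} \<noteq> Bl \<and> Bl \<subset> dl \<and> dl = du \<and> du = Bu \<and> Bu = om,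
        {} \<noteq> Bl \<and> Bl \<subset> dl \<and> dl = du \<and> du = Bu \<and> Bu \<subset> om,
        {} \<noteq> Bl \<and> Bl \<subset> dl \<and> dl = du \<and> du \<subset> Bu \<and> Bu = om,
        {} \<noteq> Bl \<and> Bl \<subset> dl \<and> dl = du \<and> du \<subset> Bu \<and> Bu \<subset> om,
        {} \<noteq> Bl \<and> Bl = dl \<and> dl \<subset> du \<and> du = Bu \<and> Bu = om,
        {} \<noteq> Bl \<and> Bl = dl \<and> dl \<subset> du \<and> du = Bu \<and> Bu \<subset> om,
        {} \<noteq> Bl \<and> Bl \<subset> dl \<and> dl \<subset> du \<and> du = Bu \<and> Bu = om,
        {} \<noteq> Bl \<and> Bl \<subset> dl \<and> dl \<subset> du \<and> du = Bu \<and> Bu \<subset> om,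
        {} \<noteq> Bl \<and> Bl = dl \<and> dl \<subset> du \<and> du \<subset> Bu \<and> Bu = om,
        {} \<noteq> Bl \<and> Bl = dl \<and> dl \<subset> du \<and> du \<subset> Bu \<and> Bu \<subset> om,
        {} \<noteq> Bl \<and> Bl \<subset> dl \<and> dl \<subset> du \<and> du \<subset> Bu \<and> Bu = om,
        {} \<noteq> Bl \<and> Bl \<subset> dl \<and> dl \<subset> du \<and> du \<subset> Bu \<and> Bu \<subset> om,
        {} \<noteq> Bl \<and> Bl = dl \<and> dl = du \<and> du \<subset> Bu \<and> Bu = om,
        {} \<noteq> Bl \<and> Bl = dl \<and> dl = du \<and> du \<subset> Bu \<and> Bu \<subset> om
      ] ! (i - 1)"
proof -
  define Bl dl du Bu om where
    "Bl = omega_density lower_Banach_density X f x"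
    and "dl = omega_density lower_density X f x"
    and "du = omega_density upper_density X f x"
    and "Bu = omega_density upper_Banach_density X f x"
    and "om = omega_limit X f x"
  note sets = this
  have chain: "Bl \<subseteq> dl" "dl \<subseteq> du" "du \<subseteq> Bu" "Bu \<subseteq> om"
    unfolding sets
    by (intro omega_density_mono lower_Banach_density_le_lower_density
        lower_density_le_upper_density upper_density_le_upper_Banach_density
        omega_upper_Banach_subset_omega_limit)+
  have "{} \<noteq> Bl"
    using assms(3) by (auto simp: sets)
  moreover have "Bl \<subset> dl \<longleftrightarrow> Bl \<noteq> dl" "dl \<subset> du \<longleftrightarrow> dl \<noteq> du" "du \<subset> Bu \<longleftrightarrow> du \<noteq> Bu"
    "Bu \<subset> om \<longleftrightarrow> Bu \<noteq> om"
    using chain by auto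
  ultimately show ?thesis
    unfolding Let_def sets[symmetric]
    by (subst ex1_nth_iff_length_filter, simp)
      (cases "Bl = dl"; cases "dl = du"; cases "du = Bu"; cases "Bu = om"; simp)
qed

end
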